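(* Let $G$ be a graph with maximum degree $\Delta(G)$. Then \[\overset{\rightarrow}{\Gamma}_{LD}(G)\geq\frac{\gamma_{LD}(G)}{\lceil\log_2\Delta(G)\rceil+1}.\]
   Context: For an undirected graph $G=(V,E)$, $S\subseteq V$ is a locating-dominating set if every $u\notin S$ has $N(u)\cap S\neq\emptyset$ and distinct $u,v\notin S$ satisfy $N(u)\cap S\neq N(v)\cap S$; $\gamma_{LD}(G)$ is the minimum size. For an orientation $D$ of $G$ (each edge given exactly one direction), $S$ is locating-dominating in $D$ if the same holds with $N(\cdot)$ replaced by the in-neighbourhood $N^-_D(\cdot)$; $\gamma_{LD}(D)$ is the minimum size. The upper directed location-domination number is $\overset{\rightarrow}{\Gamma}_{LD}(G)=\max_D\gamma_{LD}(D)$ over all orientations $D$ of $G$. *)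

theory Defs
  imports Complex_Main
begin

definition simple_graph :: "'a set \<Rightarrow> 'a set set \<Rightarrow> bool" where
  "simple_graph V E \<longleftrightarrow> finite V \<and> (\<forall>e\<in>E. \<exists>u\<in>V. \<exists>v\<in>V. u \<noteq> v \<and> e = {u, v})"

definition nbhd :: "'a set set \<Rightarrow> 'a \<Rightarrow> 'a set" where
  "nbhd E u = {v. {u, v} \<in> E}"

definition max_degree :: "'a set \<Rightarrow> 'a set set \<Rightarrow> nat" where
  "max_degree V E = Max ((\<lambda>u. card (nbhd E u)) ` V)"

(* D is the arc set of the oriented graph, on the same vertices as E;
   (u, v) is the arc from u to v. *)
definition orientation :: "'a set set \<Rightarrow> ('a \<times> 'a) set \<Rightarrow> bool" where
  "orientation E D \<longleftrightarrow>
     (\<forall>u v. (u, v) \<in> D \<longrightarrow> {u, v} \<in> E) \<and>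
     (\<forall>u v. {u, v} \<in> E \<longrightarrow> ((u, v) \<in> D \<longleftrightarrow> (v, u) \<notin> D))"

definition in_nbhd :: "('a \<times> 'a) set \<Rightarrow> 'a \<Rightarrow> 'a set" where
  "in_nbhd D u = {v. (v, u) \<in> D}"

(* The neighbourhood function N is a parameter, so that the same notion serves
   graphs (N = nbhd E) and their orientations (N = in_nbhd D). *)
definition locating_dominating :: "'a set \<Rightarrow> ('a \<Rightarrow> 'a set) \<Rightarrow> 'a set \<Rightarrow> bool" where
  "locating_dominating V N S \<longleftrightarrow> S \<subseteq> V \<and>
     (\<forall>u\<in>V - S. N u \<inter> S \<noteq> {}) \<and>
     (\<forall>u\<in>V - S. \<forall>v\<in>V - S. u \<noteq> v \<longrightarrow> N u \<inter> S \<noteq> N v \<inter> S)"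

(* V itself is always locating-dominating, so for finite V the minimum exists. *)
definition ld_number :: "'a set \<Rightarrow> ('a \<Rightarrow> 'a set) \<Rightarrow> nat" where
  "ld_number V N = Min (card ` {S. locating_dominating V N S})"

definition upper_directed_ld_number :: "'a set \<Rightarrow> 'a set set \<Rightarrow> nat" where
  "upper_directed_ld_number V E =
     Max ((\<lambda>D. ld_number V (in_nbhd D)) ` {D. orientation E D})"

end

theory Submission
  imports Defs
begin

text \<open>
  Write \<open>\<Gamma>\<close> for the upper directed location-domination number and \<open>k\<close> for the rounded-up logarithm
  of the maximum degree. We build a locating-dominating set of \<open>G\<close> as a union of \<open>k + 1\<close> sets of
  size at most \<open>\<Gamma>\<close>.
  An optimal set for an arbitrary orientation dominates \<open>G\<close>, so the vertices outside it with the same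
  trace have a common neighbour, and there are at most \<open>2 ^ k\<close> of them. Given a set \<open>U\<close> whose classes
  (vertices outside \<open>U\<close> with the same trace on \<open>U\<close>) have at most \<open>m\<close> elements, order the vertices
  linearly with every class an interval, orient all edges upwards, and let \<open>S\<close> be optimal for this
  orientation. If \<open>u < v\<close> in a class \<open>C\<close> have the same trace on \<open>U \<union> S\<close>, then only some
  \<open>s \<in> S\<close> with \<open>u < s < v\<close> can tell them apart in the orientation, and \<open>s \<in> C\<close> because \<open>C\<close> is an
  interval. Hence a class of \<open>U \<union> S\<close> alternates with elements of \<open>S\<close> inside \<open>C\<close>
  and has at most \<open>(m + 1) div 2\<close> elements. After \<open>k\<close> rounds the classes are singletons.
\<close>

definition trace_class :: "'a set \<Rightarrow> ('a \<Rightarrow> 'a set) \<Rightarrow> 'a set \<Rightarrow> 'a \<Rightarrow> 'a set" where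
  "trace_class V N U u = {v \<in> V - U. N v \<inter> U = N u \<inter> U}"

definition orient_by :: "('a \<Rightarrow> nat) \<Rightarrow> 'a set set \<Rightarrow> ('a \<times> 'a) set" where
  "orient_by f E = {(u, v). {u, v} \<in> E \<and> f u < f v}"

section \<open>Finiteness, extremal values and orientations from numberings\<close>

lemma simple_graph_edgeD:
  assumes "simple_graph V E" "{u, v} \<in> E"
  shows "u \<in> V" "v \<in> V" "u \<noteq> v"
proof -
  from assms obtain a b where "a \<in> V" "b \<in> V" "a \<noteq> b" "{u, v} = {a, b}"
    unfolding simple_graph_def by blast
  then show "u \<in> V" "v \<in> V" "u \<noteq> v" by (auto simp: doubleton_eq_iff)
qed

lemma finite_nbhd: "simple_graph V E \<Longrightarrow> finite (nbhd E u)"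
  by (rule finite_subset[of _ V]) (auto simp: nbhd_def simple_graph_edgeD(2), simp add: simple_graph_def)

lemma card_nbhd_le_max_degree:
  "simple_graph V E \<Longrightarrow> u \<in> V \<Longrightarrow> card (nbhd E u) \<le> max_degree V E"
  unfolding max_degree_def by (rule Max_ge) (auto simp: simple_graph_def)

lemma finite_locating_dominating: "finite V \<Longrightarrow> finite {S. locating_dominating V N S}"
  by (rule finite_subset[of _ "Pow V"]) (auto simp: locating_dominating_def)

lemma ld_number_le:
  "finite V \<Longrightarrow> locating_dominating V N S \<Longrightarrow> ld_number V N \<le> card S"
  unfolding ld_number_def by (intro Min_le) (auto simp: finite_locating_dominating)

lemma ld_number_attained:
  assumes "finite V"
  obtains S where "locating_dominating V N S" "card S = ld_number V N"
proof -
  have "locating_dominating V N V" by (simp add: locating_dominating_def)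
  then have "card ` {S. locating_dominating V N S} \<noteq> {}" by blast
  then have "ld_number V N \<in> card ` {S. locating_dominating V N S}"
    unfolding ld_number_def
    by (intro Min_in finite_imageI finite_locating_dominating assms)
  then show thesis using that by auto
qed

lemma finite_orientations:
  assumes "simple_graph V E"
  shows "finite {D. orientation E D}"
proof (rule finite_subset)
  show "{D. orientation E D} \<subseteq> Pow (V \<times> V)"
    using simple_graph_edgeD[OF assms] by (fastforce simp: orientation_def)
qed (use assms in \<open>simp add: simple_graph_def\<close>)

lemma orientation_locating_dominating:
  assumes "simple_graph V E" "orientation E D"
  obtains S where "locating_dominating V (in_nbhd D) S"
    "card S \<le> upper_directed_ld_number V E"
proof -
  have "ld_number V (in_nbhd D) \<le> upper_directed_ld_number V E"
    unfolding upper_directed_ld_number_def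
    using assms by (intro Max_ge) (auto simp: finite_orientations)
  moreover obtain S where "locating_dominating V (in_nbhd D) S" "card S = ld_number V (in_nbhd D)"
    using ld_number_attained assms(1) unfolding simple_graph_def by metis
  ultimately show thesis using that by simp
qed

lemma orientation_orient_by:
  assumes "simple_graph V E" "inj_on f V"
  shows "orientation E (orient_by f E)"
  unfolding orientation_def
proof (intro conjI allI impI)
  fix u v assume e: "{u, v} \<in> E"
  then have "f u \<noteq> f v"
    using simple_graph_edgeD[OF assms(1) e] assms(2) by (metis inj_on_eq_iff)
  then have "f u < f v \<longleftrightarrow> \<not> f v < f u" by linarith
  with e show "(u, v) \<in> orient_by f E \<longleftrightarrow> (v, u) \<notin> orient_by f E"
    by (simp add: orient_by_def insert_commute)
qed (simp add: orient_by_def)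

section \<open>Linear orders: numbering by blocks and counting separators\<close>

lemma exists_interval_numbering:
  assumes "finite V"
  obtains f :: "'a \<Rightarrow> nat" where "inj_on f V"
    "\<And>u v w. u \<in> V \<Longrightarrow> v \<in> V \<Longrightarrow> w \<in> V \<Longrightarrow> p u = p w \<Longrightarrow> f u < f v \<Longrightarrow> f v < f w \<Longrightarrow> p v = p u"
proof -
  obtain g :: "'a \<Rightarrow> nat" and n where g: "inj_on g V" "g ` V = {i. i < n}"
    using finite_imp_inj_to_nat_seg[OF assms] by metis
  obtain h :: "'b \<Rightarrow> nat" where h: "inj_on h (p ` V)"
    using finite_imp_inj_to_nat_seg[of "p ` V"] assms by blast
  \<comment> \<open>Two digits in base \<open>n\<close>: the high digit codes the value of
    \<open>p\<close>, the low one the vertex. The low digit makes \<open>f\<close> injective; the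
    high digit is monotone in \<open>f\<close>, so fibres of \<open>p\<close> are intervals.\<close>
  define f where "f u = h (p u) * n + g u" for u
  have gn: "g u < n" if "u \<in> V" for u using g that by blast
  have f_div: "f u div n = h (p u)" and f_mod: "f u mod n = g u" if "u \<in> V" for u
    using gn[OF that] by (simp_all add: f_def)
  have "inj_on f V"
    by (rule inj_onI) (metis f_mod g(1) inj_on_eq_iff)
  moreover have "p v = p u"
    if "u \<in> V" "v \<in> V" "w \<in> V" "p u = p w" "f u < f v" "f v < f w" for u v w
  proof -
    have "h (p u) \<le> h (p v)" "h (p v) \<le> h (p w)"
      using that div_le_mono[of "f u" "f v" n] div_le_mono[of "f v" "f w" n]
      by (simp_all add: f_div)
    then show ?thesis using that h by (metis antisym imageI inj_on_eq_iff)
  qed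
  ultimately show thesis using that by blast
qed

text \<open>Remove the largest element \<open>b\<close>: separators of pairs in the remaining
  \<open>X\<close> lie below \<open>Max X\<close>, whereas one between \<open>Max X\<close> and
  \<open>b\<close> does not, so each removal costs at least one separator.\<close>

lemma card_le_Suc_card_separators:
  fixes X T :: "'a::linorder set"
  assumes "finite X" "finite T"
    "\<And>x y. x \<in> X \<Longrightarrow> y \<in> X \<Longrightarrow> x < y \<Longrightarrow> \<exists>t\<in>T. x < t \<and> t < y"
  shows "card X \<le> Suc (card T)"
  using assms
proof (induction X arbitrary: T rule: finite_linorder_max_induct)
  case empty
  then show ?case by simp
next
  case (insert b X)
  show ?case
  proof (cases "X = {}")
    case True
    then show ?thesis by simp
  next
    case False
    let ?m = "Max X"
    let ?T = "{t \<in> T. t < ?m}"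
    have m: "?m \<in> X" using insert False by simp
    with insert obtain t where t: "t \<in> T" "?m < t" by (metis insert_iff)
    have "card X \<le> Suc (card ?T)"
    proof (rule insert.IH)
      fix x y assume "x \<in> X" "y \<in> X" "x < y"
      moreover from this insert obtain s where "s \<in> T" "x < s" "s < y" by (metis insert_iff)
      moreover have "y \<le> ?m" using \<open>y \<in> X\<close> insert by simp
      ultimately show "\<exists>s\<in>?T. x < s \<and> s < y" by force
    qed (use insert in simp)
    moreover have "card ?T < card T"
    proof (rule psubset_card_mono)
      show "?T \<subset> T" using t by (auto dest: less_asym)
    qed (use insert.prems in simp)
    moreover have "card (insert b X) = Suc (card X)"
      using insert by (subst card_insert_disjoint) auto
    ultimately show ?thesis by simp
  qed
qed

section \<open>Trace classes: initial bound and halving\<close>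

lemma dominating_trace_class_le:
  assumes G: "simple_graph V E" and u: "u \<in> V - S" "nbhd E u \<inter> S \<noteq> {}"
  shows "card (trace_class V (nbhd E) S u) \<le> max_degree V E"
proof -
  obtain w where w: "w \<in> nbhd E u" "w \<in> S" using u by blast
  then have "w \<in> nbhd E v" if "v \<in> trace_class V (nbhd E) S u" for v
    using that unfolding trace_class_def by blast
  then have "trace_class V (nbhd E) S u \<subseteq> nbhd E w"
    by (simp add: nbhd_def insert_commute subset_iff)
  then have "card (trace_class V (nbhd E) S u) \<le> card (nbhd E w)"
    using finite_nbhd[OF G] by (intro card_mono) auto
  moreover have "w \<in> V" using w simple_graph_edgeD[OF G] by (auto simp: nbhd_def)
  ultimately show ?thesis using card_nbhd_le_max_degree[OF G] le_trans by blast
qed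

lemma halve_trace_classes:
  assumes G: "simple_graph V E"
    and cls: "\<And>u. u \<in> V - U \<Longrightarrow> card (trace_class V (nbhd E) U u) \<le> m"
  obtains S where "S \<subseteq> V" "card S \<le> upper_directed_ld_number V E"
    "\<And>u. u \<in> V - (U \<union> S) \<Longrightarrow> card (trace_class V (nbhd E) (U \<union> S) u) \<le> (m + 1) div 2"
proof -
  have finV: "finite V" using G by (simp add: simple_graph_def)
  \<comment> \<open>Vertices of \<open>U\<close> get a block of their own: one lying inside a class could separate its members
    without belonging to the class.\<close>
  define p where "p u = (if u \<in> U then None else Some (nbhd E u \<inter> U))" for u
  obtain f :: "'a \<Rightarrow> nat" where inj: "inj_on f V"
    and int: "\<And>u v w. u \<in> V \<Longrightarrow> v \<in> V \<Longrightarrow> w \<in> V \<Longrightarrow> p u = p w \<Longrightarrow> f u < f v \<Longrightarrow> f v < f w \<Longrightarrow> p v = p u"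
    using exists_interval_numbering[OF finV, of p] by metis
  let ?D = "orient_by f E"
  obtain S where S: "locating_dominating V (in_nbhd ?D) S"
    and cardS: "card S \<le> upper_directed_ld_number V E"
    using orientation_locating_dominating[OF G orientation_orient_by[OF G inj]] by blast
  have SV: "S \<subseteq> V" using S by (simp add: locating_dominating_def)
  have "card (trace_class V (nbhd E) (U \<union> S) u) \<le> (m + 1) div 2" if u: "u \<in> V - (U \<union> S)" for u
  proof -
    let ?X = "trace_class V (nbhd E) (U \<union> S) u"
    let ?C = "trace_class V (nbhd E) U u"
    let ?T = "?C \<inter> S"
    have XC: "?X \<subseteq> ?C - S" by (auto simp: trace_class_def)
    have CV: "?C \<subseteq> V" by (auto simp: trace_class_def)
    have finC: "finite ?C" using CV finV finite_subset by blast
    have finX: "finite ?X" using XC finC finite_subset by blast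
    have "\<exists>t\<in>?T. f x < f t \<and> f t < f y" if xy: "x \<in> ?X" "y \<in> ?X" "f x < f y" for x y
    proof -
      have V: "x \<in> V - S" "y \<in> V - S" "x \<noteq> y" using xy by (auto simp: trace_class_def)
      then have "in_nbhd ?D x \<inter> S \<noteq> in_nbhd ?D y \<inter> S"
        using S unfolding locating_dominating_def by blast
      then obtain s where s: "s \<in> S" "(s, x) \<in> ?D \<longleftrightarrow> (s, y) \<notin> ?D"
        by (auto simp: in_nbhd_def)
      have "nbhd E x \<inter> (U \<union> S) = nbhd E y \<inter> (U \<union> S)"
        using xy by (simp add: trace_class_def)
      then have "s \<in> nbhd E x \<longleftrightarrow> s \<in> nbhd E y" using s by blast
      then have adj: "{s, x} \<in> E \<longleftrightarrow> {s, y} \<in> E" by (simp add: nbhd_def insert_commute)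
      \<comment> \<open>By \<open>adj\<close>, \<open>s\<close> can distinguish \<open>x\<close>
        from \<open>y\<close> only through its position; below \<open>x\<close> it would also be
        below \<open>y\<close>, giving both arcs or neither.\<close>
      have "\<not> f s < f x" and sy: "f s < f y"
        using s adj xy(3) by (auto simp: orient_by_def)
      moreover have "s \<in> V" using SV s by blast
      moreover have "s \<noteq> x" using V s by blast
      ultimately have xs: "f x < f s"
        using inj V by (metis DiffD1 inj_on_eq_iff linorder_neqE_nat)
      have "x \<in> ?C" "y \<in> ?C" using xy XC by auto
      then have "p x = Some (nbhd E u \<inter> U)" "p x = p y"
        by (auto simp: p_def trace_class_def)
      with int[of x s y] V \<open>s \<in> V\<close> xs sy have "p s = Some (nbhd E u \<inter> U)" by simp
      then have "s \<in> ?C"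
        using \<open>s \<in> V\<close> by (auto simp: p_def trace_class_def split: if_splits)
      with s xs sy show ?thesis by blast
    qed
    \<comment> \<open>Counting takes place among the numbers \<open>f\<close>, since the vertices
      carry no order of their own.\<close>
    then have "card (f ` ?X) \<le> Suc (card (f ` ?T))"
      using finX finC by (intro card_le_Suc_card_separators) auto
    moreover have "card (f ` ?X) = card ?X"
      using XC CV by (intro card_image inj_on_subset[OF inj]) blast
    moreover have "card (f ` ?T) \<le> card ?T" using finC by (intro card_image_le) simp
    \<comment> \<open>\<open>?X\<close> avoids \<open>S\<close> and \<open>?T\<close> lies in
      \<open>S\<close>, so they are disjoint in \<open>?C\<close>. With the separator count this
      gives \<open>2 * card ?X \<le> m + 1\<close>.\<close>
    moreover have "card ?X + card ?T \<le> card ?C"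
    proof -
      have "card ?X + card ?T = card (?X \<union> ?T)"
        using finX finC XC by (intro card_Un_disjoint[symmetric]) auto
      also have "\<dots> \<le> card ?C" using XC finC by (intro card_mono) auto
      finally show ?thesis .
    qed
    moreover have "card ?C \<le> m" using cls u by simp
    ultimately show ?thesis by linarith
  qed
  with that SV cardS show thesis by blast
qed

text \<open>Domination is part of the invariant because only the first set guarantees it; it
  persists as \<open>U\<close> grows.\<close>

lemma iterate_halving:
  assumes G: "simple_graph V E" and k: "max_degree V E \<le> 2 ^ k"
  shows "j \<le> k \<Longrightarrow> \<exists>U\<subseteq>V. card U \<le> (j + 1) * upper_directed_ld_number V E \<and>
    (\<forall>u\<in>V - U. nbhd E u \<inter> U \<noteq> {} \<and> card (trace_class V (nbhd E) U u) \<le> 2 ^ (k - j))"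
proof (induction j)
  case 0
  have "finite V" using G by (simp add: simple_graph_def)
  then obtain f :: "'a \<Rightarrow> nat" where "inj_on f V"
    using finite_imp_inj_to_nat_seg by blast
  then obtain S where S: "locating_dominating V (in_nbhd (orient_by f E)) S"
    and "card S \<le> upper_directed_ld_number V E"
    using orientation_locating_dominating[OF G orientation_orient_by[OF G]] by blast
  moreover have "in_nbhd (orient_by f E) u \<subseteq> nbhd E u" for u
    by (auto simp: in_nbhd_def orient_by_def nbhd_def insert_commute)
  then have "nbhd E u \<inter> S \<noteq> {}" if "u \<in> V - S" for u
    using S that unfolding locating_dominating_def by blast
  moreover from this have "card (trace_class V (nbhd E) S u) \<le> 2 ^ k" if "u \<in> V - S" for u
    using dominating_trace_class_le[OF G] that k le_trans by blast
  ultimately show ?case by (intro exI[of _ S]) (auto simp: locating_dominating_def)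
next
  case (Suc j)
  then obtain U where U: "U \<subseteq> V" "card U \<le> (j + 1) * upper_directed_ld_number V E"
    and dom: "\<And>u. u \<in> V - U \<Longrightarrow> nbhd E u \<inter> U \<noteq> {}"
    and cls: "\<And>u. u \<in> V - U \<Longrightarrow> card (trace_class V (nbhd E) U u) \<le> 2 ^ (k - j)"
    by auto
  obtain S where S: "S \<subseteq> V" "card S \<le> upper_directed_ld_number V E"
    and half: "\<And>u. u \<in> V - (U \<union> S) \<Longrightarrow>
      card (trace_class V (nbhd E) (U \<union> S) u) \<le> (2 ^ (k - j) + 1) div 2"
    using halve_trace_classes[OF G cls] by blast
  have "k - j = Suc (k - Suc j)" using Suc.prems by simp
  \<comment> \<open>The exponent is positive, so the power is even and the extra 1 is lost in
    rounding.\<close>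
  then have "(2 ^ (k - j) + 1) div 2 = (2 ^ (k - Suc j) :: nat)" by simp
  moreover have "card (U \<union> S) \<le> (Suc j + 1) * upper_directed_ld_number V E"
    using card_Un_le[of U S] U S by simp
  ultimately show ?case
    using U S dom half by (intro exI[of _ "U \<union> S"]) (simp, blast)
qed

section \<open>From singleton classes to the logarithmic bound\<close>

lemma ld_number_le_mult_upper_directed:
  assumes G: "simple_graph V E" and k: "max_degree V E \<le> 2 ^ k"
  shows "ld_number V (nbhd E) \<le> (k + 1) * upper_directed_ld_number V E"
proof -
  have finV: "finite V" using G by (simp add: simple_graph_def)
  obtain U where U: "U \<subseteq> V" "card U \<le> (k + 1) * upper_directed_ld_number V E"
    and dom: "\<And>u. u \<in> V - U \<Longrightarrow> nbhd E u \<inter> U \<noteq> {}"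
    and cls: "\<And>u. u \<in> V - U \<Longrightarrow> card (trace_class V (nbhd E) U u) \<le> 1"
    using iterate_halving[OF G k, of k] by auto
  have "u = v" if "u \<in> V - U" "v \<in> V - U" "nbhd E u \<inter> U = nbhd E v \<inter> U" for u v
  proof -
    have "finite (trace_class V (nbhd E) U u)" using finV by (simp add: trace_class_def)
    moreover have "u \<in> trace_class V (nbhd E) U u" "v \<in> trace_class V (nbhd E) U u"
      using that by (auto simp: trace_class_def)
    ultimately show ?thesis using cls[OF that(1)] by (simp add: card_le_Suc0_iff_eq)
  qed
  then have "locating_dominating V (nbhd E) U"
    using U dom unfolding locating_dominating_def by blast
  then show ?thesis using ld_number_le[OF finV] U le_trans by blast
qed

lemma le_two_power_ceiling_log: "n \<le> 2 ^ nat \<lceil>log 2 (real n)\<rceil>"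
proof (cases "n = 0")
  case False
  then have "real n = 2 powr log 2 (real n)" by simp
  also have "\<dots> \<le> 2 powr real (nat \<lceil>log 2 (real n)\<rceil>)"
    by (intro powr_mono real_nat_ceiling_ge) simp
  also have "\<dots> = real (2 ^ nat \<lceil>log 2 (real n)\<rceil>)" by (simp add: powr_realpow)
  finally show ?thesis by linarith
qed simp

theorem theorem36:
  fixes V :: "'a set" and E :: "'a set set"
  assumes "simple_graph V E"
  shows "real (upper_directed_ld_number V E) \<ge>
           real (ld_number V (nbhd E)) / (real_of_int \<lceil>log 2 (real (max_degree V E))\<rceil> + 1)"
proof -
  let ?k = "nat \<lceil>log 2 (real (max_degree V E))\<rceil>"
  \<comment> \<open>For maximum degree 0 the junk value \<open>log 2 0 = 0\<close> makes the denominator 1.\<close>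
  have "0 \<le> log 2 (real (max_degree V E))"
    by (cases "max_degree V E = 0") (simp_all add: log_def)
  then have k: "real_of_int \<lceil>log 2 (real (max_degree V E))\<rceil> = real ?k" by simp
  have "ld_number V (nbhd E) \<le> (?k + 1) * upper_directed_ld_number V E"
    using ld_number_le_mult_upper_directed[OF assms le_two_power_ceiling_log] .
  then have "real (ld_number V (nbhd E)) \<le> real ((?k + 1) * upper_directed_ld_number V E)"
    by (simp only: of_nat_le_iff)
  then show ?thesis unfolding k by (simp add: divide_le_eq algebra_simps)
qed

end
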